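(* In the model described in the context, if $2g+1\le k\le 3g-2$, then there is an algorithm that solves the $g$-partial gathering problem in dynamic (1-interval connected) rings within $O(n\log g)$ rounds and with a total of $O(gn\log g)$ agent moves.
   Context: Model. A dynamic bidirectional ring has anonymous nodes $v_0,\dots,v_{n-1}$ and links $e_i=\{v_i,v_{i+1 \bmod n}\}$; in each round an adversary may make at most one link missing (1-interval connectivity). Each node has a whiteboard that agents located there can read and write. There are $k\le n$ agents, which are deterministic finite automata with distinct IDs, knowledge of $n$ and $k$, and chirality (a common notion of forward $v_i\to v_{i+1}$ and backward $v_i\to v_{i-1}$). Agents cannot directly detect other agents at their node. Initially agents occupy pairwise distinct nodes, and a node's whiteboard is initially in one of two special states according to whether an agent starts there. Execution is fully synchronous: in each round every agent atomically reads the whiteboard, changes state, writes the whiteboard, and either stays or tries to move to a neighbouring node; if the link it tries to traverse is missing in that round it is blocked and stays. An agent terminates by entering a final state, after which it never acts. Problem. For a given positive integer $g<k$, an algorithm solves the $g$-partial gathering problem if every execution (against every adversary) is finite (all agents terminate) and in the final configuration every node hosting at least one agent hosts at least $g$ agents. Complexity measures: the number of rounds until all agents terminate, and the total number of moves (successful link traversals) made by all agents. *)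

theory Defs
  imports Complex_Main
begin

datatype dir = Stay | Forward | Backward

text \<open>
  One protocol per parameter triple \<open>(n, k, g)\<close>. Agent states and whiteboard contents are
  natural numbers, which loses no generality because the state sets are finite (for each bound
  on the IDs). A transition depends only on the ID and state of the agent and on the whiteboard
  it reads: it sees neither node names, nor other agents, nor whether its last move was blocked.
\<close>

record protocol =
  init_state :: "nat \<Rightarrow> nat"  \<comment> \<open>argument: ID\<close>
  final_states :: "nat set"
  board_empty :: nat  \<comment> \<open>initial whiteboard of a node where no agent starts\<close>
  board_home :: nat   \<comment> \<open>initial whiteboard of a node where an agent starts\<close>
  delta :: "nat \<Rightarrow> nat \<Rightarrow> nat \<Rightarrow> nat \<times> nat \<times> dir"
    \<comment> \<open>ID, state, whiteboard to new state, new whiteboard, attempted move\<close>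

text \<open>
  Agents may store IDs in their memory and on whiteboards, so finiteness is relative to a
  bound \<open>N\<close> on the IDs in use. The protocol itself does not depend on \<open>N\<close>.
\<close>

definition finite_automata :: "protocol \<Rightarrow> bool" where
  "finite_automata P \<longleftrightarrow>
     board_empty P \<noteq> board_home P \<and>
     (\<forall>N. \<exists>S W. finite S \<and> finite W \<and>
        board_empty P \<in> W \<and> board_home P \<in> W \<and>
        (\<forall>a<N. init_state P a \<in> S) \<and>
        (\<forall>a<N. \<forall>s\<in>S. \<forall>w\<in>W. delta P a s w \<in> S \<times> W \<times> UNIV))"

text \<open>
  Agents are identified with their IDs. Besides the initial placement, a scenario fixes the
  choices of the adversary: the missing link (if any) of each round, and the order in which
  the agents perform their atomic actions within a round, which matters only for agents
  that share a node. As protocols are deterministic, quantifying over all such sequences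
  covers adaptive adversaries.
\<close>

record scenario =
  ids :: "nat set"
  home :: "nat \<Rightarrow> nat"
  missing :: "nat \<Rightarrow> nat option"
  schedule :: "nat \<Rightarrow> nat list"

definition valid_scenario :: "nat \<Rightarrow> nat \<Rightarrow> scenario \<Rightarrow> bool" where
  "valid_scenario n k E \<longleftrightarrow>
     finite (ids E) \<and> card (ids E) = k \<and>
     inj_on (home E) (ids E) \<and> home E ` ids E \<subseteq> {..<n} \<and>
     (\<forall>t e. missing E t = Some e \<longrightarrow> e < n) \<and>
     (\<forall>t. distinct (schedule E t) \<and> set (schedule E t) = ids E)"

record config =
  loc :: "nat \<Rightarrow> nat"    \<comment> \<open>agent to node\<close>
  state :: "nat \<Rightarrow> nat"  \<comment> \<open>agent to state\<close>
  board :: "nat \<Rightarrow> nat"  \<comment> \<open>node to whiteboard\<close>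
  moves :: nat           \<comment> \<open>link traversals so far; invisible to the agents\<close>

definition init_config :: "protocol \<Rightarrow> scenario \<Rightarrow> config" where
  "init_config P E =
     \<lparr> loc = home E,
       state = init_state P,
       board = (\<lambda>v. if v \<in> home E ` ids E then board_home P else board_empty P),
       moves = 0 \<rparr>"

text \<open>Link \<open>i\<close> joins the nodes \<open>i\<close> and \<open>(i + 1) mod n\<close>.\<close>

fun dest :: "nat \<Rightarrow> nat \<Rightarrow> dir \<Rightarrow> nat" where
  "dest n v Stay = v"
| "dest n v Forward = (v + 1) mod n"
| "dest n v Backward = (v + n - 1) mod n"

fun link :: "nat \<Rightarrow> nat \<Rightarrow> dir \<Rightarrow> nat option" where
  "link n v Stay = None"
| "link n v Forward = Some v"
| "link n v Backward = Some ((v + n - 1) mod n)"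

definition traverses :: "nat \<Rightarrow> nat option \<Rightarrow> nat \<Rightarrow> dir \<Rightarrow> bool" where
  "traverses n m v d \<longleftrightarrow> d \<noteq> Stay \<and> link n v d \<noteq> m"

definition act :: "protocol \<Rightarrow> nat \<Rightarrow> nat option \<Rightarrow> nat \<Rightarrow> config \<Rightarrow> config" where
  "act P n m a c =
     (if state c a \<in> final_states P then c
      else let v = loc c a; (s, w, d) = delta P a (state c a) (board c v) in
        \<lparr> loc = (if traverses n m v d then (loc c)(a := dest n v d) else loc c),
          state = (state c)(a := s),
          board = (board c)(v := w),
          moves = (if traverses n m v d then Suc (moves c) else moves c) \<rparr>)"

text \<open>
  Every agent acts exactly once per round and cannot see other agents, so carrying out each
  move together with its action agrees with moving all agents at the end of the round.
\<close>

primrec run :: "protocol \<Rightarrow> nat \<Rightarrow> scenario \<Rightarrow> nat \<Rightarrow> config" where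
  "run P n E 0 = init_config P E"
| "run P n E (Suc t) = fold (act P n (missing E t)) (schedule E t) (run P n E t)"

definition all_terminated :: "protocol \<Rightarrow> scenario \<Rightarrow> config \<Rightarrow> bool" where
  "all_terminated P E c \<longleftrightarrow> (\<forall>a\<in>ids E. state c a \<in> final_states P)"

definition partially_gathered :: "nat \<Rightarrow> scenario \<Rightarrow> config \<Rightarrow> bool" where
  "partially_gathered g E c \<longleftrightarrow>
     (\<forall>v. (\<exists>a\<in>ids E. loc c a = v) \<longrightarrow> g \<le> card {a \<in> ids E. loc c a = v})"

definition halts :: "protocol \<Rightarrow> nat \<Rightarrow> scenario \<Rightarrow> bool" where
  "halts P n E \<longleftrightarrow> (\<exists>t. all_terminated P E (run P n E t))"

definition rounds :: "protocol \<Rightarrow> nat \<Rightarrow> scenario \<Rightarrow> nat" where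
  "rounds P n E = (LEAST t. all_terminated P E (run P n E t))"

definition final_config :: "protocol \<Rightarrow> nat \<Rightarrow> scenario \<Rightarrow> config" where
  "final_config P n E = run P n E (rounds P n E)"

definition total_moves :: "protocol \<Rightarrow> nat \<Rightarrow> scenario \<Rightarrow> nat" where
  "total_moves P n E = moves (final_config P n E)"

definition solves_partial_gathering :: "protocol \<Rightarrow> nat \<Rightarrow> nat \<Rightarrow> nat \<Rightarrow> bool" where
  "solves_partial_gathering P n k g \<longleftrightarrow>
     (\<forall>E. valid_scenario n k E \<longrightarrow>
        halts P n E \<and> partially_gathered g E (final_config P n E))"

end

theory Submission
  imports Defs "HOL-Library.Nat_Bijection"
begin

text \<open>
  Every visit to a node is recorded on its whiteboard, so co-located agents can learn each other's
  IDs by waiting for one round. Agents that keep moving in the same direction stay together once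
  they have met, and agents at different nodes are never blocked in the same round by one missing
  link unless they attempt it from opposite ends.

  First everyone walks forward for \<open>3 n\<close> rounds, which teaches all agents the smallest ID; then
  everyone walks forward to the home of that ID for \<open>2 n\<close> rounds, after which all agents that have
  not arrived stand at a single node. As \<open>k > 2 g\<close>, one of these two groups has at least \<open>g\<close> members;
  its node is a base and its members wait. While the other group has fewer than \<open>g\<close> members, it
  splits into two halves that search for the base in opposite directions. One of the halves arrives,
  since the two would face the same link only after jointly visiting every node. So \<open>O(log g)\<close>
  phases leave at most one seeker. At that point the base holds \<open>k - 1 \<ge> 2 g\<close> agents and can send
  out \<open>g\<close> of them to march forward behind the seeker, who also walks forward and therefore
  reaches the base or is caught. The bound on the moves is \<open>k \<le> 3 g\<close> times the number of rounds.
\<close>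

section \<open>Walkers on a ring with one missing link per round\<close>

definition travel :: "nat \<Rightarrow> nat option \<Rightarrow> nat \<Rightarrow> dir \<Rightarrow> nat" where
  "travel n m v d = (if traverses n m v d then dest n v d else v)"

lemma travel_simps [simp]:
  "travel n m v Stay = v"
  "travel n m v Forward = (if m = Some v then v else (v + 1) mod n)"
  "travel n m v Backward = (if m = Some ((v + n - 1) mod n) then v else (v + n - 1) mod n)"
  by (auto simp: travel_def traverses_def)

lemma travel_less: "v < n \<Longrightarrow> travel n m v d < n"
  by (cases d) auto

text \<open>Link \<open>v\<close> leads forward from node \<open>v\<close>, so the trajectory of a
  forward walker is also the sequence of links it attempts and can serve as
  \<open>e\<close>.\<close>

definition advance :: "(nat \<Rightarrow> nat option) \<Rightarrow> (nat \<Rightarrow> nat) \<Rightarrow> nat \<Rightarrow> nat" where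
  "advance m e r = (\<Sum>i<r. if m i = Some (e i) then 0 else 1)"

lemma advance_0 [simp]: "advance m e 0 = 0"
  by (simp add: advance_def)

lemma advance_Suc [simp]:
  "advance m e (Suc r) = advance m e r + (if m r = Some (e r) then 0 else 1)"
  by (simp add: advance_def)

text \<open>The count starts at 0 and grows by at most one per round, so it cannot pass
  \<open>d\<close> without hitting it.\<close>

lemma advance_below:
  assumes "0 < d" "\<forall>r\<le>R. advance m e r \<noteq> d" "r \<le> R"
  shows "advance m e r < d"
  using assms(3)
proof (induction r)
  case (Suc r)
  then have "advance m e r < d" "advance m e (Suc r) \<noteq> d" using assms(2) by auto
  then show ?case by (auto split: if_splits)
qed (use assms(1) in simp)

text \<open>A single missing link blocks at most one of two walkers that attempt different
  links.\<close>

lemma advance_pair: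
  assumes "\<forall>i<R. e i \<noteq> f i" "r \<le> R"
  shows "r \<le> advance m e r + advance m f r"
  using assms(2)
proof (induction r)
  case (Suc r)
  then have "e r \<noteq> f r" using assms(1) by auto
  with Suc show ?case by auto
qed simp

lemma forward_position:
  assumes "\<forall>r<R. p (Suc r) = travel n (m r) (p r) Forward" "p 0 < n" "r \<le> R"
  shows "p r = (p 0 + advance m p r) mod n"
  using assms(3)
proof (induction r)
  case (Suc r)
  then have "p r = (p 0 + advance m p r) mod n" by simp
  then show ?case using Suc.prems assms(1)
    by (auto simp: mod_Suc_eq)
qed (use assms(2) in simp)

lemma backward_position:
  assumes "\<forall>r<R. q (Suc r) = travel n (m r) (q r) Backward" "q 0 < n" "r \<le> R"
  shows "q r < n \<and> (q r + advance m (\<lambda>i. (q i + n - 1) mod n) r) mod n = q 0"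
  using assms(3)
proof (induction r)
  case (Suc r)
  let ?y = "advance m (\<lambda>i. (q i + n - 1) mod n)"
  have IH: "q r < n" "(q r + ?y r) mod n = q 0" using Suc by auto
  have "((q r + n - 1) mod n + Suc (?y r)) mod n = (q r + n - 1 + Suc (?y r)) mod n"
    by (simp only: mod_add_left_eq)
  also have "q r + n - 1 + Suc (?y r) = (q r + ?y r) + n" using IH(1) by simp
  finally have "((q r + n - 1) mod n + Suc (?y r)) mod n = q 0" using IH(2) by simp
  then show ?case using Suc.prems assms(1) IH by auto
qed (use assms(2) in simp)

lemma forward_distance:
  fixes u v n :: nat
  assumes "u < n" "v < n" "u \<noteq> v"
  obtains d where "0 < d" "d < n" "(u + d) mod n = v"
proof
  let ?d = "if u < v then v - u else v + n - u"
  show "0 < ?d" "?d < n" "(u + ?d) mod n = v" using assms by auto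
qed

text \<open>Forward walkers at one node attempt the same link and share their fate, so they never
  separate after meeting.\<close>

lemma forward_apart_before:
  assumes p: "\<forall>r<R. p (Suc r) = travel n (m r) (p r) Forward"
    and q: "\<forall>r<R. q (Suc r) = travel n (m r) (q r) Forward"
    and "p R \<noteq> q R" "r \<le> R"
  shows "p r \<noteq> q r"
proof
  assume eq: "p r = q r"
  have "r \<le> s \<Longrightarrow> s \<le> R \<Longrightarrow> p s = q s" for s
  proof (induction s rule: dec_induct)
    case (step s)
    then show ?case using p q by simp
  qed (rule eq)
  then show False using assms by blast
qed

lemma forward_pair:
  assumes p: "\<forall>r<R. p (Suc r) = travel n (m r) (p r) Forward"
    and q: "\<forall>r<R. q (Suc r) = travel n (m r) (q r) Forward"
    and "p R \<noteq> q R" "r \<le> R"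
  shows "r \<le> advance m p r + advance m q r"
  using advance_pair[of R p q r m] forward_apart_before[OF p q \<open>p R \<noteq> q R\<close>] assms(4)
  by auto

lemma forward_avoiding:
  assumes p: "\<forall>r<R. p (Suc r) = travel n (m r) (p r) Forward"
    and "p 0 < n" "\<forall>r\<le>R. p r \<noteq> v" "0 < d" "(p 0 + d) mod n = v" "r \<le> R"
  shows "advance m p r < d"
proof (rule advance_below[where R = R])
  show "\<forall>r\<le>R. advance m p r \<noteq> d"
    using forward_position[OF p] assms by metis
qed (use assms in auto)

lemma forward_avoiding_less:
  assumes p: "\<forall>r<R. p (Suc r) = travel n (m r) (p r) Forward"
    and p0: "p 0 < n" and v: "v < n" and avoid: "\<forall>r\<le>R. p r \<noteq> v" and "r \<le> R"
  shows "advance m p r < n"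
proof -
  have "p 0 \<noteq> v" using avoid by blast
  then obtain d where d: "0 < d" "d < n" "(p 0 + d) mod n = v"
    using forward_distance[OF p0 v] by blast
  then show ?thesis using forward_avoiding[OF p p0 avoid d(1,3) \<open>r \<le> R\<close>] by linarith
qed

text \<open>Unmerged walkers make at least \<open>R\<close> moves together, but each makes fewer
  than \<open>n\<close> while it avoids \<open>v\<close>.\<close>

lemma forward_searchers_merge:
  assumes p: "\<forall>r<R. p (Suc r) = travel n (m r) (p r) Forward"
    and q: "\<forall>r<R. q (Suc r) = travel n (m r) (q r) Forward"
    and p0: "p 0 < n" and q0: "q 0 < n" and v: "v < n"
    and avoid: "\<forall>r\<le>R. p r \<noteq> v" "\<forall>r\<le>R. q r \<noteq> v" and R: "2 * n \<le> R"
  shows "p R = q R"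
proof (rule ccontr)
  assume "p R \<noteq> q R"
  then have "R \<le> advance m p R + advance m q R" using forward_pair[OF p q] by blast
  moreover have "advance m p R < n" "advance m q R < n"
    using forward_avoiding_less[OF p p0 v avoid(1)] forward_avoiding_less[OF q q0 v avoid(2)]
    by blast+
  ultimately show False using R by linarith
qed

text \<open>\<open>q\<close> makes fewer than \<open>n - d\<close> moves without reaching the start
  of \<open>p\<close>, and \<open>p\<close> cannot make up its lag \<open>d\<close> without meeting
  \<open>q\<close>. Together that is fewer than \<open>2 * n\<close> moves.\<close>

lemma forward_chaser_catches:
  assumes p: "\<forall>r<R. p (Suc r) = travel n (m r) (p r) Forward"
    and q: "\<forall>r<R. q (Suc r) = travel n (m r) (q r) Forward"
    and p0: "p 0 < n" and q0: "q 0 < n"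
    and avoid: "\<forall>r\<le>R. q r \<noteq> p 0" and R: "2 * n \<le> R"
  shows "p R = q R"
proof (rule ccontr)
  assume apart: "p R \<noteq> q R"
  have "p 0 \<noteq> q 0" using avoid by (metis zero_le)
  then obtain d where d: "0 < d" "d < n" "(p 0 + d) mod n = q 0"
    using forward_distance[OF p0 q0] by blast
  have "(q 0 + (n - d)) mod n = (p 0 + d + (n - d)) mod n"
    unfolding d(3)[symmetric] by (simp only: mod_add_left_eq)
  also have "\<dots> = p 0" using d p0 by simp
  finally have y: "advance m q r < n - d" if "r \<le> R" for r
    using forward_avoiding[OF q q0 avoid _ _ that, of "n - d"] d by simp
  \<comment> \<open>The lead of \<open>q\<close> drops by at most one per round, and lead 0 would be
    a meeting.\<close>
  have x: "advance m p r < d + advance m q r" if "r \<le> R" for r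
    using that
  proof (induction r)
    case (Suc r)
    have "advance m p (Suc r) \<noteq> d + advance m q (Suc r)"
    proof
      assume "advance m p (Suc r) = d + advance m q (Suc r)"
      then have "p (Suc r) = (p 0 + d + advance m q (Suc r)) mod n"
        using forward_position[OF p p0 Suc.prems] by (simp only: add.assoc)
      also have "\<dots> = (q 0 + advance m q (Suc r)) mod n"
        unfolding d(3)[symmetric] by (simp only: mod_add_left_eq)
      also have "\<dots> = q (Suc r)" using forward_position[OF q q0 Suc.prems] by (rule sym)
      finally show False using forward_apart_before[OF p q apart Suc.prems] by blast
    qed
    moreover have "advance m p r < d + advance m q r" using Suc by simp
    ultimately show ?case by (auto split: if_splits)
  qed (use d in simp)
  have "R \<le> advance m p R + advance m q R" using forward_pair[OF p q apart] by blast
  with x[of R] y[of R] R show False by linarith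
qed

text \<open>Walkers that left \<open>u\<close> with \<open>x\<close> forward and \<open>y\<close>
  backward moves face the same link only if \<open>n\<close> divides
  \<open>x + y + 1\<close>.\<close>

lemma links_differ:
  fixes u v w x y n :: nat
  assumes "v < n" "(v + y) mod n = u" "w = (u + x) mod n" "x + y + 1 < n"
  shows "w \<noteq> (v + n - 1) mod n"
proof -
  have wrap: "a mod n = a \<and> a < n \<or> a mod n = a - n \<and> n \<le> a" if "a < 2 * n" for a
    using that by (cases "a < n") (auto simp: le_mod_geq)
  have "u < n" using assms by auto
  then show ?thesis
    using assms wrap[of "v + y"] wrap[of "u + x"] wrap[of "v + n - 1"] by linarith
qed

text \<open>With \<open>v\<close> at forward distance \<open>d\<close>, failing walkers make at most
  \<open>d - 1\<close> and \<open>n - d - 1\<close> moves. They then never attempt a common link,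
  which yields \<open>R \<ge> n\<close> moves, a contradiction.\<close>

lemma opposite_searchers_arrive:
  assumes p: "\<forall>r<R. p (Suc r) = travel n (m r) (p r) Forward"
    and q: "\<forall>r<R. q (Suc r) = travel n (m r) (q r) Backward"
    and p0: "p 0 < n" and start: "q 0 = p 0" and v: "v < n" and R: "n \<le> R"
  shows "\<exists>r\<le>R. p r = v \<or> q r = v"
proof (rule ccontr)
  assume "\<not> ?thesis"
  then have av: "\<forall>r\<le>R. p r \<noteq> v" "\<forall>r\<le>R. q r \<noteq> v" by auto
  define y where "y = advance m (\<lambda>i. (q i + n - 1) mod n)"
  have "p 0 \<noteq> v" using av by blast
  then obtain d where d: "0 < d" "d < n" "(p 0 + d) mod n = v"
    using forward_distance[OF p0 v] by blast
  have x_less: "advance m p r < d" if "r \<le> R" for r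
    using forward_avoiding[OF p p0 av(1) d(1,3) that] .
  have q0: "q 0 < n" using p0 start by simp
  have q_pos: "q r < n" "(q r + y r) mod n = p 0" if "r \<le> R" for r
    using backward_position[OF q q0 that] start unfolding y_def by simp_all
  have y_less: "y r < n - d" if "r \<le> R" for r
    unfolding y_def
  proof (rule advance_below[where R = R])
    have "y r \<noteq> n - d" if "r \<le> R" for r
    proof
      assume "y r = n - d"
      then have "(q r + (n - d)) mod n = p 0" using q_pos(2)[OF that] by simp
      then have "v = ((q r + (n - d)) mod n + d) mod n" using d(3) by simp
      also have "\<dots> = (q r + (n - d) + d) mod n" by (simp only: mod_add_left_eq)
      also have "\<dots> = q r" using d(2) q_pos(1)[OF that] by simp
      finally show False using av(2) that by metis
    qed
    then show "\<forall>r\<le>R. advance m (\<lambda>i. (q i + n - 1) mod n) r \<noteq> n - d"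
      unfolding y_def by blast
  qed (use d(2) that in simp_all)
  \<comment> \<open>The two agents would attempt the same link only after having jointly visited every node.\<close>
  have "p r \<noteq> (q r + n - 1) mod n" if "r < R" for r
  proof (rule links_differ)
    have r: "r \<le> R" using that by simp
    show "p r = (p 0 + advance m p r) mod n" using forward_position[OF p p0 r] .
    show "q r < n" "(q r + y r) mod n = p 0" using q_pos[OF r] .
    show "advance m p r + y r + 1 < n" using x_less[OF r] y_less[OF r] by linarith
  qed
  then have "R \<le> advance m p R + y R"
    unfolding y_def by (intro advance_pair[of R]) auto
  then show False using x_less[of R] y_less[of R] R by linarith
qed

text \<open>Over \<open>3 n\<close> rounds two unmerged agents together make at least \<open>3 n\<close> moves, while neither can
  gain \<open>n\<close> moves on the other without meeting it; so both go all the way around.\<close>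

lemma forward_visits_start:
  assumes p: "\<forall>r<R. p (Suc r) = travel n (m r) (p r) Forward"
    and q: "\<forall>r<R. q (Suc r) = travel n (m r) (q r) Forward"
    and p0: "p 0 < n" and q0: "q 0 < n" and apart: "p R \<noteq> q R" and R: "3 * n \<le> R"
  shows "\<exists>r\<le>R. 0 < r \<and> p r = q 0"
proof -
  have ne: "p r \<noteq> q r" if "r \<le> R" for r
    using forward_apart_before[OF p q apart that] .
  have sum: "R \<le> advance m p R + advance m q R" using forward_pair[OF p q apart] by blast
  obtain d where d: "0 < d" "d < n" "(p 0 + d) mod n = q 0"
    using forward_distance[OF p0 q0 ne[of 0]] by auto
  have "n \<le> advance m p R"
  proof (rule ccontr)
    assume "\<not> n \<le> advance m p R"
    then have "advance m p R + n \<le> d + advance m q R" using sum R by linarith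
    \<comment> \<open>\<open>?f r\<close> is the distance from \<open>p\<close> forward to
      \<open>q\<close>, not reduced mod \<open>n\<close>. It changes by at most one per round and
      climbs from \<open>d < n\<close> to at least \<open>n\<close>; at the value \<open>n\<close>
      both share a node.\<close>
    moreover let ?f = "\<lambda>r. int d + int (advance m q r) - int (advance m p r)"
    have "\<forall>i<R. \<bar>?f (i + 1) - ?f i\<bar> \<le> 1" by auto
    ultimately obtain r where r: "r \<le> R" "?f r = int n"
      using nat0_intermed_int_val[of R ?f "int n"] d by auto
    then have "advance m p r + n = d + advance m q r" by linarith
    have "p r = (p 0 + advance m p r + n) mod n" using forward_position[OF p p0 r(1)] by simp
    also have "\<dots> = (p 0 + d + advance m q r) mod n"
      using \<open>advance m p r + n = d + advance m q r\<close> by (simp only: add.assoc)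
    also have "\<dots> = (q 0 + advance m q r) mod n"
      unfolding d(3)[symmetric] by (simp only: mod_add_left_eq)
    also have "\<dots> = q r" using forward_position[OF q q0 r(1)] by (rule sym)
    finally show False using ne[OF r(1)] by blast
  qed
  moreover have "\<forall>i<R. \<bar>int (advance m p (i + 1)) - int (advance m p i)\<bar> \<le> 1" by auto
  ultimately obtain r where r: "r \<le> R" "int (advance m p r) = int d"
    using nat0_intermed_int_val[of R "\<lambda>r. int (advance m p r)" "int d"] d by auto
  then have "p r = q 0" using forward_position[OF p p0 r(1)] d(3) by simp
  moreover have "0 < r" using r(2) d(1) by (cases r) auto
  ultimately show ?thesis using r(1) by blast
qed

section \<open>Schedule and local rules of the agents\<close>

text \<open>The \<open>i\<close>-th census is taken in round \<open>census n i\<close>: nobody moves in it, so in the next round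
  every agent finds on its whiteboard the IDs of all agents at its node.\<close>

definition census :: "nat \<Rightarrow> nat \<Rightarrow> nat" where
  "census n i = 5 * n + 1 + i * (2 * n + 1)"

definition levels :: "nat \<Rightarrow> nat" where
  "levels g = nat \<lceil>log 2 (real g)\<rceil>"

definition rank :: "nat set \<Rightarrow> nat \<Rightarrow> nat" where
  "rank C a = card {b \<in> C. b < a}"

text \<open>Modes: \<open>0\<close> and \<open>1\<close> search backward and forward for a base, \<open>2\<close> marches forward without
  stopping. A view \<open>V\<close> contains \<open>(s, b)\<close> iff agent \<open>b\<close> was at the node in the earlier round \<open>s\<close>.\<close>

definition next_mode :: "nat \<Rightarrow> nat \<Rightarrow> nat \<Rightarrow> nat \<Rightarrow> nat \<Rightarrow> nat \<Rightarrow> (nat \<times> nat) set \<Rightarrow> nat" where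
  "next_mode n k g t a e V =
     (if \<exists>i. t = Suc (census n i) then
        let C = {b. (t - 1, b) \<in> V} in
        if t < census n (levels g) then (if 2 * rank C a < card C then 1 else 0)
        else if card C + 1 = k \<and> rank C a < g then 2 else 1
      else e)"

text \<open>\<open>(0, m) \<in> V\<close> recognises the home of agent \<open>m\<close>, and the
  records of census 0 reveal a base. Mode 2 is tested before the base so that marchers can leave
  it.\<close>

definition heading :: "nat \<Rightarrow> nat \<Rightarrow> nat \<Rightarrow> nat \<Rightarrow> nat \<Rightarrow> (nat \<times> nat) set \<Rightarrow> dir" where
  "heading n g t m e V =
     (if t < 3 * n then Forward
      else if t = 3 * n then Stay
      else if t < census n 0 then (if (0, m) \<in> V then Stay else Forward)
      else if \<exists>i. t = census n i then Stay
      else if e = 2 then Forward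
      else if g \<le> card {b. (census n 0, b) \<in> V} then Stay
      else if e = 1 then Forward else Backward)"

lemma census_mono: "i < j \<Longrightarrow> census n i < census n j"
  unfolding census_def by (intro add_strict_left_mono mult_strict_right_mono) auto

lemma census_Suc: "census n (Suc i) = census n i + 2 * n + 1"
  by (simp add: census_def)

lemma not_census_between:
  assumes "census n i < t" "t < census n (Suc i)"
  shows "t \<noteq> census n j"
  using assms census_mono[of j i n] census_mono[of "Suc i" j n]
  by (metis less_antisym less_irrefl less_trans linorder_neqE_nat)

text \<open>Ranks number \<open>C\<close> from 0 without gaps: a new maximum gets rank
  \<open>card A\<close> and changes no other rank.\<close>

lemma card_rank_less:
  assumes "finite C"
  shows "card {a \<in> C. rank C a < j} = min j (card C)"
  using assms
proof (induction C rule: finite_linorder_max_induct)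
  case (insert b A)
  have "rank (insert b A) a = rank A a" if "a \<in> A" for a
    using insert that unfolding rank_def by (intro arg_cong[where f = card]) auto
  moreover have "{c \<in> insert b A. c < b} = A" using insert by auto
  then have "rank (insert b A) b = card A" by (simp add: rank_def)
  ultimately have "{a \<in> insert b A. rank (insert b A) a < j}
      = {a \<in> A. rank A a < j} \<union> (if card A < j then {b} else {})"
    by auto
  moreover have "b \<notin> A" using insert by auto
  ultimately show ?case using insert by (auto simp: min_def)
qed simp

section \<open>Abstract runs and learning the leader\<close>

locale gathering_run =
  fixes n k g :: nat and agents :: "nat set" and missing :: "nat \<Rightarrow> nat option"
    and pos mem mode :: "nat \<Rightarrow> nat \<Rightarrow> nat" and view :: "nat \<Rightarrow> nat \<Rightarrow> (nat \<times> nat) set"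
  assumes g: "3 \<le> g" and k: "2 * g + 1 \<le> k" and n: "k \<le> n"
    and finite_agents: "finite agents" and card_agents: "card agents = k"
    and inj_start: "inj_on (pos 0) agents"
    and start: "a \<in> agents \<Longrightarrow> pos 0 a < n"
    and mem_0: "a \<in> agents \<Longrightarrow> mem 0 a = a"
    and view: "view t v = {(s, b). s < t \<and> b \<in> agents \<and> pos s b = v}"
    and mem_Suc: "\<lbrakk>a \<in> agents; t < census n (Suc (levels g))\<rbrakk> \<Longrightarrow>
      mem (Suc t) a = Min (insert (mem t a) (snd ` view t (pos t a)))"
    and mode_Suc: "\<lbrakk>a \<in> agents; t < census n (Suc (levels g))\<rbrakk> \<Longrightarrow>
      mode (Suc t) a = next_mode n k g t a (mode t a) (view t (pos t a))"
    and pos_Suc: "\<lbrakk>a \<in> agents; t < census n (Suc (levels g))\<rbrakk> \<Longrightarrow>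
      pos (Suc t) a = travel n (missing t) (pos t a)
        (heading n g t (mem (Suc t) a) (mode (Suc t) a) (view t (pos t a)))"
begin

definition leader :: nat where "leader = Min agents"

lemma leader: "leader \<in> agents" "a \<in> agents \<Longrightarrow> leader \<le> a"
  using finite_agents card_agents k unfolding leader_def
  by (metis Min_in card.empty not_less_eq_eq zero_le Suc_eq_plus1, simp)

lemma pos_less: "a \<in> agents \<Longrightarrow> t \<le> census n (Suc (levels g)) \<Longrightarrow> pos t a < n"
  by (induction t) (auto simp: start pos_Suc travel_less simp del: travel_simps)

lemma early: "t \<le> 5 * n + 1 \<Longrightarrow> t < census n (Suc (levels g))"
  by (simp add: census_def)

lemma finite_view: "finite (view t v)"
  by (rule finite_subset[of _ "{..<t} \<times> agents"]) (auto simp: view finite_agents)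

lemma mem_in: "a \<in> agents \<Longrightarrow> t \<le> census n (Suc (levels g)) \<Longrightarrow> mem t a \<in> agents"
proof (induction t)
  case (Suc t)
  have "mem (Suc t) a \<in> insert (mem t a) (snd ` view t (pos t a))"
    using Suc.prems mem_Suc[of a t] finite_view Min_in[of "insert (mem t a) (snd ` view t (pos t a))"]
    by simp
  then show ?case using Suc by (auto simp: view)
qed (simp add: mem_0)

text \<open>\<open>mem\<close> never increases and is always the ID of some agent, so it stays at
  the minimum once reached.\<close>

lemma mem_leader:
  assumes a: "a \<in> agents" and "(s, leader) \<in> view t (pos t a)"
    and "t < u" "u \<le> census n (Suc (levels g))"
  shows "mem u a = leader"
proof -
  let ?S = "\<lambda>t. insert (mem t a) (snd ` view t (pos t a))"
  have "Suc t \<le> u" using assms(3) by simp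
  then have "mem u a \<le> leader"
    using assms(4)
  proof (induction u rule: dec_induct)
    case base
    have "leader \<in> ?S t" using assms(2) by (auto intro: rev_image_eqI)
    then show ?case using base mem_Suc[OF a, of t] finite_view by (auto intro: Min_le)
  next
    case (step u)
    have "mem (Suc u) a \<le> mem u a"
      using step mem_Suc[OF a, of u] finite_view by (auto intro: Min_le)
    then show ?case using step by simp
  qed
  then show ?thesis using leader(2)[OF mem_in[OF a assms(4)]] by simp
qed

text \<open>An agent that merged with the leader reads its record after the rest in round
  \<open>3 * n\<close>; any other agent has visited the leader's home, which holds its record of
  round 0.\<close>

lemma knows_leader:
  assumes a: "a \<in> agents" and u: "3 * n + 2 \<le> u" "u \<le> census n (Suc (levels g))"
  shows "mem u a = leader"
proof (cases "pos (3 * n) a = pos (3 * n) leader")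
  case True
  have "pos (Suc (3 * n)) a = pos (3 * n) a"
    using pos_Suc[OF a early] by (simp add: heading_def)
  then have "(3 * n, leader) \<in> view (Suc (3 * n)) (pos (Suc (3 * n)) a)"
    using True leader(1) by (simp add: view)
  then show ?thesis using mem_leader[OF a] u by simp
next
  case False
  have "\<forall>r<3 * n. pos (Suc r) b = travel n (missing r) (pos r b) Forward" if "b \<in> agents" for b
    using pos_Suc[OF that early] by (simp add: heading_def del: travel_simps)
  \<comment> \<open>\<open>0 < r\<close> matters: the record of round 0 is readable only from round
    1 on.\<close>
  then obtain r where r: "r \<le> 3 * n" "0 < r" "pos r a = pos 0 leader"
    using forward_visits_start[of "3 * n" "\<lambda>r. pos r a" n missing "\<lambda>r. pos r leader"]
      False start a leader(1) by auto
  then have "(0, leader) \<in> view r (pos r a)" using leader(1) by (simp add: view)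
  then show ?thesis using mem_leader[OF a, of 0 r u] u r by simp
qed

section \<open>Two groups, bases and seekers\<close>

definition hub :: nat where "hub = pos 0 leader"

text \<open>Whoever reaches \<open>hub\<close> stays, so two agents elsewhere walked forward for
  \<open>2 * n\<close> rounds avoiding it and have merged.\<close>

lemma two_groups:
  assumes a: "a \<in> agents" "pos (census n 0) a \<noteq> hub"
    and b: "b \<in> agents" "pos (census n 0) b \<noteq> hub"
  shows "pos (census n 0) a = pos (census n 0) b"
proof -
  define p where "p c r = pos (3 * n + 1 + r) c" for c r
  have walk: "p c (Suc r) = travel n (missing (3 * n + 1 + r)) (p c r)
      (if p c r = hub then Stay else Forward)" if "c \<in> agents" "r < 2 * n" for c r
  proof -
    have "mem (Suc (3 * n + 1 + r)) c = leader"
      using knows_leader[OF that(1)] that(2) by (simp add: census_def)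
    then show ?thesis
      using pos_Suc[OF that(1) early, of "3 * n + 1 + r"] that leader(1)
      by (auto simp: p_def heading_def census_def hub_def view simp del: travel_simps)
  qed
  have end_pos: "p c (2 * n) = pos (census n 0) c" for c
    by (simp add: p_def census_def add.commute)
  have avoid: "p c r \<noteq> hub"
    if "c \<in> agents" "pos (census n 0) c \<noteq> hub" "r \<le> 2 * n" for c r
  proof
    assume "p c r = hub"
    have "p c (2 * n) = hub"
      using that(3)
    proof (induction rule: dec_induct)
      case (step s)
      then show ?case using walk[OF that(1)] by simp
    qed (rule \<open>p c r = hub\<close>)
    then show False using end_pos that(2) by simp
  qed
  have fwd: "\<forall>r<2 * n. p c (Suc r) = travel n (missing (3 * n + 1 + r)) (p c r) Forward"
    if "c \<in> agents" "pos (census n 0) c \<noteq> hub" for c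
    using walk[OF that(1)] avoid[OF that] by (simp del: travel_simps)
  have less: "p c 0 < n" if "c \<in> agents" for c
    using pos_less[OF that] early by (simp add: p_def less_imp_le)
  have "hub < n" using start leader(1) by (simp add: hub_def)
  then have "p a (2 * n) = p b (2 * n)"
    using forward_searchers_merge[OF fwd[OF a] fwd[OF b] less[OF a(1)] less[OF b(1)], of hub]
      avoid[OF a] avoid[OF b] by blast
  then show ?thesis using end_pos by simp
qed

definition group :: "nat \<Rightarrow> nat \<Rightarrow> nat set" where
  "group i v = {b \<in> agents. pos (census n i) b = v}"

definition based :: "nat \<Rightarrow> bool" where
  "based v \<longleftrightarrow> g \<le> card (group 0 v)"

definition seekers :: "nat \<Rightarrow> nat set" where
  "seekers i = {a \<in> agents. \<not> based (pos (census n i) a)}"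

lemma finite_group: "finite (group i v)"
  by (simp add: group_def finite_agents)

lemma finite_seekers: "finite (seekers i)"
  by (simp add: seekers_def finite_agents)

lemma based_occupied: "based v \<Longrightarrow> \<exists>a\<in>agents. pos (census n 0) a = v"
proof -
  assume "based v"
  then have "group 0 v \<noteq> {}" using g unfolding based_def by auto
  then show ?thesis by (auto simp: group_def)
qed

text \<open>All agents outside the group at \<open>hub\<close> share one node, and
  \<open>k > 2 * g\<close> gives one of the two groups \<open>g\<close> members.\<close>

lemma base_exists: "\<exists>v<n. based v"
proof (cases "g \<le> card (group 0 hub)")
  case True
  then show ?thesis using start leader(1) by (auto simp: hub_def based_def)
next
  case False
  define Z where "Z = agents - group 0 hub"
  have "card Z = k - card (group 0 hub)"
    unfolding Z_def using card_agents finite_group by (subst card_Diff_subset) (auto simp: group_def)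
  then have Z: "g \<le> card Z" "0 < card Z" using False k by auto
  then obtain z where z: "z \<in> Z" by fastforce
  then have "Z \<subseteq> group 0 (pos (census n 0) z)"
    using two_groups by (auto simp: Z_def group_def)
  then have "based (pos (census n 0) z)"
    using Z(1) card_mono[OF finite_group] unfolding based_def by (meson order_trans)
  moreover have "pos (census n 0) z < n"
    using pos_less z census_mono[of 0 "Suc (levels g)" n] by (auto simp: Z_def)
  ultimately show ?thesis by blast
qed

text \<open>At most two nodes are occupied at census 0 and one is a base, which leaves one for the
  seekers.\<close>

lemma seekers_0_together:
  assumes "a \<in> seekers 0" "b \<in> seekers 0"
  shows "pos (census n 0) a = pos (census n 0) b"
proof -
  obtain v where v: "based v" using base_exists by blast
  obtain c where c: "c \<in> agents" "pos (census n 0) c = v" using based_occupied[OF v] by blast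
  show ?thesis
    using two_groups[of a b] two_groups[of a c] two_groups[of c b] assms v c
    unfolding seekers_def by (metis (no_types, lifting) mem_Collect_eq)
qed

lemma card_seekers_0: "card (seekers 0) < g"
proof (cases "seekers 0 = {}")
  case False
  then obtain z where z: "z \<in> seekers 0" by blast
  have "seekers 0 \<subseteq> group 0 (pos (census n 0) z)"
    using seekers_0_together[OF z] by (auto simp: group_def seekers_def)
  then have "card (seekers 0) \<le> card (group 0 (pos (census n 0) z))"
    by (rule card_mono[OF finite_group])
  then show ?thesis using z by (simp add: seekers_def based_def)
qed (use g in simp)

text \<open>A seeker and two bases would occupy three nodes. Without seekers both groups may be
  bases.\<close>

lemma base_unique:
  assumes "seekers 0 \<noteq> {}" "based u" "based v"
  shows "u = v"
proof -
  obtain a where "a \<in> seekers 0" using assms by blast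
  moreover obtain b where "b \<in> agents" "pos (census n 0) b = u"
    using based_occupied assms by blast
  moreover obtain c where "c \<in> agents" "pos (census n 0) c = v"
    using based_occupied assms by blast
  ultimately show ?thesis
    using two_groups[of a b] two_groups[of a c] two_groups[of b c] assms
    unfolding seekers_def by (metis (no_types, lifting) mem_Collect_eq)
qed

section \<open>Trajectories within one phase\<close>

definition role :: "nat \<Rightarrow> nat \<Rightarrow> nat" where
  "role i a = (let C = group i (pos (census n i) a) in
     if i < levels g then (if 2 * rank C a < card C then 1 else 0)
     else if card C + 1 = k \<and> rank C a < g then 2 else 1)"

definition path :: "nat \<Rightarrow> nat \<Rightarrow> nat \<Rightarrow> nat" where
  "path i a r = pos (census n i + 1 + r) a"

lemma phase_time: "i \<le> levels g \<Longrightarrow> r \<le> 2 * n \<Longrightarrow> census n i + r < census n (Suc (levels g))"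
  using census_mono[of i "levels g" n] census_Suc[of n "levels g"]
  by (cases "i = levels g") auto

lemma path_0:
  assumes "a \<in> agents" "i \<le> levels g"
  shows "path i a 0 = pos (census n i) a"
proof -
  have "heading n g (census n i) m e V = Stay" for m e V
    by (auto simp: heading_def census_def)
  then show ?thesis using pos_Suc[OF assms(1)] phase_time[OF assms(2), of 0] by (simp add: path_def)
qed

lemma path_less: "a \<in> agents \<Longrightarrow> i \<le> levels g \<Longrightarrow> r \<le> 2 * n \<Longrightarrow> path i a r < n"
  using pos_less[of a "census n i + 1 + r"] phase_time[of i r] by (simp add: path_def)

lemma path_end: "path i a (2 * n) = pos (census n (Suc i)) a"
  by (simp add: path_def census_Suc)

lemma mode_role:
  assumes a: "a \<in> agents" and i: "i \<le> levels g" and "r < 2 * n"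
  shows "mode (census n i + 2 + r) a = role i a"
  using assms(3)
proof (induction r)
  case 0
  have "pos (Suc (census n i)) a = pos (census n i) a"
    using path_0[OF a i] by (simp add: path_def)
  moreover have "{b. (census n i, b) \<in> view (Suc (census n i)) v} = group i v" for v
    by (auto simp: view group_def)
  \<comment> \<open>\<open>next_mode\<close> tells the search phases from the last one by the round
    alone.\<close>
  moreover have "Suc (census n i) < census n (levels g) \<longleftrightarrow> i < levels g"
    using census_Suc[of n i] census_mono[of "Suc i" "levels g" n] census_mono[of i "levels g" n] 0 i
    by (cases "i = levels g"; cases "Suc i = levels g") auto
  ultimately show ?case
    using mode_Suc[OF a, of "Suc (census n i)"] phase_time[OF i, of 1] 0
    by (auto simp: next_mode_def role_def Let_def)
next
  case (Suc r)
  let ?t = "census n i + 2 + r"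
  have "census n i + 1 + r \<noteq> census n j" for j
    using Suc.prems by (intro not_census_between[of n i]) (auto simp: census_Suc)
  then have "?t \<noteq> Suc (census n j)" for j
    by (metis Suc_inject add_2_eq_Suc' add_Suc add.commute plus_1_eq_Suc)
  then have "mode (Suc ?t) a = mode ?t a"
    using mode_Suc[OF a, of ?t] phase_time[OF i, of "2 + r"] Suc.prems
    by (simp add: next_mode_def add.assoc)
  then show ?case using Suc by simp
qed

lemma path_Suc:
  assumes a: "a \<in> agents" and i: "i \<le> levels g" and r: "r < 2 * n"
  shows "path i a (Suc r) = travel n (missing (census n i + 1 + r)) (path i a r)
    (if role i a = 2 then Forward else if based (path i a r) then Stay
     else if role i a = 1 then Forward else Backward)"
proof -
  let ?t = "census n i + 1 + r"
  have t: "?t \<noteq> census n j" for j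
    using r by (intro not_census_between[of n i]) (auto simp: census_Suc)
  have "\<not> ?t < census n 0" using census_mono[of 0 i n] by (cases i) auto
  moreover have "\<not> ?t < 3 * n" "?t \<noteq> 3 * n" by (auto simp: census_def)
  moreover have "census n 0 < ?t" using t[of 0] calculation(1) by simp
  then have "{b. (census n 0, b) \<in> view ?t v} = group 0 v" for v
    by (auto simp: view group_def)
  moreover have "mode (Suc ?t) a = role i a" using mode_role[OF a i r] by simp
  ultimately show ?thesis
    using pos_Suc[OF a, of ?t] phase_time[OF i, of "1 + r"] r t
    by (simp add: path_def heading_def based_def add.assoc del: travel_simps)
qed

lemma role_search: "i < levels g \<Longrightarrow> role i a \<noteq> 2"
  by (simp add: role_def Let_def)

lemma based_absorbing:
  assumes a: "a \<in> agents" "role i a \<noteq> 2" and i: "i \<le> levels g"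
    and "based (path i a r)" "r \<le> 2 * n"
  shows "pos (census n (Suc i)) a = path i a r"
proof -
  have "path i a (2 * n) = path i a r"
    using assms(5)
  proof (induction rule: dec_induct)
    case (step s)
    then show ?case using path_Suc[OF a(1) i] a(2) assms(4) by simp
  qed simp
  then show ?thesis by (simp add: path_end)
qed

text \<open>Agents with equal node and role move as one, so the two-walker lemmas apply to whole
  groups through representatives.\<close>

lemma path_determined:
  assumes "a \<in> agents" "b \<in> agents" "i \<le> levels g" "role i a = role i b"
    "pos (census n i) a = pos (census n i) b" "r \<le> 2 * n"
  shows "path i a r = path i b r"
  using assms(6)
proof (induction r)
  case 0
  then show ?case using assms path_0 by simp
next
  case (Suc r)
  then show ?case using assms path_Suc by simp
qed

text \<open>Only marchers can leave a base, and they exist only in the last phase.\<close>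

lemma seekers_Suc:
  assumes "i < levels g"
  shows "seekers (Suc i) \<subseteq> seekers i"
proof
  fix a assume a: "a \<in> seekers (Suc i)"
  then have "\<not> based (path i a 0)"
    using based_absorbing[of a i 0] role_search[OF assms] assms by (auto simp: seekers_def)
  then show "a \<in> seekers i" using a path_0[of a i] assms by (auto simp: seekers_def)
qed

lemma seekers_subset: "i \<le> levels g \<Longrightarrow> seekers i \<subseteq> seekers 0"
proof (induction i)
  case (Suc i)
  then show ?case using seekers_Suc[of i] by auto
qed simp

lemma group_0_subset:
  assumes "i \<le> levels g" "based v"
  shows "group 0 v \<subseteq> group i v"
  using assms(1)
proof (induction i)
  case (Suc i)
  have "pos (census n (Suc i)) a = v" if "a \<in> group i v" for a
    using based_absorbing[of a i 0] path_0[of a i] role_search[of i a] Suc.prems that assms(2)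
    by (auto simp: group_def)
  then show ?case using Suc by (auto simp: group_def)
qed simp

lemma seeker_avoids:
  assumes "a \<in> agents" "role i a \<noteq> 2" "i \<le> levels g" "\<not> based (pos (census n (Suc i)) a)" "r \<le> 2 * n"
  shows "\<not> based (path i a r)"
  using based_absorbing assms by metis

section \<open>Halving the seekers\<close>

text \<open>The seekers form the entire group at their node, so \<open>role\<close> splits them into
  a forward and a backward half. By \<open>opposite_searchers_arrive\<close> members of different
  halves cannot both remain, and a remaining half moves as one.\<close>

lemma halves:
  assumes i: "i < levels g"
    and together: "\<And>a b. a \<in> seekers i \<Longrightarrow> b \<in> seekers i \<Longrightarrow> pos (census n i) a = pos (census n i) b"
  shows "card (seekers (Suc i)) \<le> (card (seekers i) + 1) div 2 \<and>
    (\<forall>a\<in>seekers (Suc i). \<forall>b\<in>seekers (Suc i).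
       pos (census n (Suc i)) a = pos (census n (Suc i)) b)"
proof -
  let ?S = "seekers i"
  \<comment> \<open>\<open>2 * rank < card\<close> amounts to
    \<open>rank < (card + 1) div 2\<close>, so \<open>F\<close> is the forward half, rounded
    up.\<close>
  define F where "F = {a \<in> ?S. rank ?S a < (card ?S + 1) div 2}"
  have le: "i \<le> levels g" using i by simp
  have role: "role i a = (if a \<in> F then 1 else 0)" if "a \<in> ?S" for a
  proof -
    have "group i (pos (census n i) a) = ?S"
    proof (intro equalityI subsetI)
      fix b assume "b \<in> group i (pos (census n i) a)"
      then show "b \<in> ?S" using that by (simp add: group_def seekers_def)
    next
      fix b assume b: "b \<in> ?S"
      then show "b \<in> group i (pos (census n i) a)"
        unfolding group_def using together[OF b that] by (simp add: seekers_def)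
    qed
    then show ?thesis using i that by (auto simp: role_def F_def Let_def)
  qed
  have F: "card F = (card ?S + 1) div 2"
    unfolding F_def card_rank_less[OF finite_seekers] by (simp add: min_def)
  have "F \<subseteq> ?S" by (auto simp: F_def)
  then have B: "card (?S - F) \<le> (card ?S + 1) div 2"
    using F finite_subset[OF _ finite_seekers] by (simp add: card_Diff_subset)
  have "\<not> (a \<in> F \<and> b \<notin> F)" if ab: "a \<in> seekers (Suc i)" "b \<in> seekers (Suc i)" for a b
  proof
    assume *: "a \<in> F \<and> b \<notin> F"
    have S: "a \<in> ?S" "b \<in> ?S" using ab seekers_Suc[OF i] by auto
    then have ags: "a \<in> agents" "b \<in> agents" by (auto simp: seekers_def)
    have roles: "role i a = 1" "role i b = 0" using role S * by auto
    have avoid: "\<not> based (path i a r)" "\<not> based (path i b r)" if "r \<le> 2 * n" for r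
      using seeker_avoids[OF ags(1) _ le _ that] seeker_avoids[OF ags(2) _ le _ that] roles ab
      by (simp_all add: seekers_def)
    let ?m = "\<lambda>r. missing (census n i + 1 + r)"
    have "\<forall>r<2 * n. path i a (Suc r) = travel n (?m r) (path i a r) Forward"
      using path_Suc[OF ags(1) le] roles avoid by (simp del: travel_simps)
    moreover have "\<forall>r<2 * n. path i b (Suc r) = travel n (?m r) (path i b r) Backward"
      using path_Suc[OF ags(2) le] roles avoid by (simp del: travel_simps)
    moreover obtain v where "v < n" "based v" using base_exists by blast
    moreover have "path i b 0 = path i a 0" 
      using path_0[OF ags(1) le] path_0[OF ags(2) le] together[OF S] by simp
    ultimately show False
      using opposite_searchers_arrive[of "2 * n" "path i a" n ?m "path i b" v]
        path_less[OF ags(1) le, of 0] avoid by auto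
  qed
  then have sub: "seekers (Suc i) \<subseteq> F \<or> seekers (Suc i) \<subseteq> ?S - F"
    using seekers_Suc[OF i] by blast
  then have "card (seekers (Suc i)) \<le> (card ?S + 1) div 2"
  proof
    assume "seekers (Suc i) \<subseteq> F"
    then show ?thesis using F card_mono[of F] finite_subset[OF \<open>F \<subseteq> ?S\<close> finite_seekers] by metis
  next
    assume "seekers (Suc i) \<subseteq> ?S - F"
    then show ?thesis using B card_mono[of "?S - F"] finite_seekers by (meson finite_Diff order_trans)
  qed
  moreover have "pos (census n (Suc i)) a = pos (census n (Suc i)) b"
    if ab: "a \<in> seekers (Suc i)" "b \<in> seekers (Suc i)" for a b
  proof -
    have S: "a \<in> ?S" "b \<in> ?S" using ab seekers_Suc[OF i] by auto
    have "role i a = role i b" using role S sub ab by auto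
    then have "path i a (2 * n) = path i b (2 * n)"
      using path_determined[OF _ _ le _ together[OF S]] S by (simp add: seekers_def)
    then show ?thesis by (simp add: path_end)
  qed
  ultimately show ?thesis by blast
qed

lemma power_levels: "g \<le> 2 ^ levels g"
proof -
  have "real g = 2 powr (log 2 (real g))" using g by simp
  also have "\<dots> \<le> 2 powr real (levels g)"
    unfolding levels_def by (intro powr_mono) (simp_all add: real_nat_ceiling_ge)
  also have "\<dots> = 2 ^ levels g" by (simp add: powr_realpow)
  finally show ?thesis by (metis of_nat_le_iff of_nat_numeral of_nat_power)
qed

text \<open>Halving with rounding up still turns a bound \<open>2 ^ (j + 1)\<close> into
  \<open>2 ^ j\<close>, so at most one seeker is left after \<open>levels g\<close> phases.\<close>

lemma seekers_shrink:
  "i \<le> levels g \<Longrightarrow> card (seekers i) \<le> 2 ^ (levels g - i) \<and>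
    (\<forall>a\<in>seekers i. \<forall>b\<in>seekers i. pos (census n i) a = pos (census n i) b)"
proof (induction i)
  case 0
  have "card (seekers 0) \<le> 2 ^ levels g" using card_seekers_0 power_levels by linarith
  then show ?case unfolding diff_zero using seekers_0_together by blast
next
  case (Suc i)
  have "i \<le> levels g" using Suc.prems by simp
  then have IH: "card (seekers i) \<le> 2 ^ (levels g - i)"
    "\<And>a b. a \<in> seekers i \<Longrightarrow> b \<in> seekers i \<Longrightarrow> pos (census n i) a = pos (census n i) b"
    using Suc.IH by blast+
  have "2 ^ (levels g - i) = (2::nat) * 2 ^ (levels g - Suc i)"
    using Suc.prems by (metis Suc_diff_le diff_Suc_Suc power_Suc)
  then have "(card (seekers i) + 1) div 2 \<le> 2 ^ (levels g - Suc i)" using IH(1) by simp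
  moreover have "i < levels g" using Suc.prems by simp
  note halves[OF this IH(2)]
  ultimately show ?case by (meson order_trans)
qed

section \<open>The last phase\<close>

text \<open>Without seekers nobody moves. Otherwise the base holds \<open>k - 1\<close> agents:
  \<open>g\<close> march, at least \<open>g\<close> stay, and the seeker ends with one of these
  parties.\<close>

lemma gathered:
  assumes a: "a \<in> agents"
  shows "g \<le> card {b \<in> agents. pos (census n (Suc (levels g))) b = pos (census n (Suc (levels g))) a}"
proof -
  let ?L = "levels g"
  let ?end = "pos (census n (Suc ?L))"
  have fin: "finite {b \<in> agents. P b}" for P using finite_agents by simp
  have base_group: "g \<le> card (group ?L v)" if "based v" for v
    using that card_mono[OF finite_group group_0_subset[OF order_refl that]]
    by (simp add: based_def)
  have rest: "?end c = pos (census n ?L) c"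
    if "c \<in> agents" "role ?L c \<noteq> 2" "based (pos (census n ?L) c)" for c
    using based_absorbing[OF that(1,2) order_refl, of 0] path_0[OF that(1)] that(3) by simp
  show ?thesis
  proof (cases "seekers ?L = {}")
    case True
    then have all_based: "based (pos (census n ?L) c)" if "c \<in> agents" for c
      using that by (auto simp: seekers_def)
    \<comment> \<open>A march needs exactly one agent outside the group, but that agent would be at
      another base, among at least \<open>g > 1\<close> agents.\<close>
    have "role ?L c \<noteq> 2" if c: "c \<in> agents" for c
    proof
      assume "role ?L c = 2"
      then have C: "card (group ?L (pos (census n ?L) c)) + 1 = k" (is "card ?C + 1 = k")
        by (auto simp: role_def Let_def split: if_splits)
      then have "?C \<noteq> agents" using card_agents by auto
      then obtain b where b: "b \<in> agents" "b \<notin> ?C" by (auto simp: group_def)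
      let ?B = "group ?L (pos (census n ?L) b)"
      have "?C \<inter> ?B = {}" "?C \<union> ?B \<subseteq> agents" using b by (auto simp: group_def)
      then have "card ?C + card ?B \<le> k"
        using card_Un_disjoint[OF finite_group finite_group] card_mono[OF finite_agents] card_agents
        by metis
      then show False using base_group[OF all_based[OF b(1)]] C g by simp
    qed
    then have "?end c = pos (census n ?L) c" if "c \<in> agents" for c
      using rest all_based that by simp
    then have "{b \<in> agents. ?end b = ?end a} = group ?L (pos (census n ?L) a)"
      using a by (auto simp: group_def)
    then show ?thesis using base_group all_based a by simp
  next
    case False
    moreover have "card (seekers ?L) \<le> 1" using seekers_shrink[of ?L] by simp
    ultimately obtain s where s: "seekers ?L = {s}"
      by (metis One_nat_def card_1_singletonE card_gt_0_iff finite_seekers le_antisym Suc_leI)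
    obtain v where v: "v < n" "based v" using base_exists by blast
    have "seekers 0 \<noteq> {}" using seekers_subset[of ?L] s by auto
    then have only_v: "based u \<longleftrightarrow> u = v" for u using base_unique v by blast
    have s_agent: "s \<in> agents" and s_pos: "pos (census n ?L) s \<noteq> v"
      using s only_v by (auto simp: seekers_def)
    have at_v: "pos (census n ?L) c = v" if "c \<in> agents" "c \<noteq> s" for c
      using s only_v that by (auto simp: seekers_def)
    have base: "group ?L v = agents - {s}"
      using at_v s_pos by (auto simp: group_def)
    have "group ?L (pos (census n ?L) s) = {s}"
      using s_agent s_pos at_v unfolding group_def by fastforce
    then have role_s: "role ?L s = 1" using g k by (simp add: role_def)
    define H where "H = {c \<in> group ?L v. rank (group ?L v) c < g}"
    have card_base: "card (group ?L v) = k - 1"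
      using base s_agent card_agents finite_agents by simp
    then have card_H: "card H = g"
      unfolding H_def card_rank_less[OF finite_group] using k by simp
    have H_agents: "H \<subseteq> agents - {s}" using base by (auto simp: H_def)
    have role_c: "role ?L c = (if c \<in> H then 2 else 1)" if "c \<in> agents" "c \<noteq> s" for c
      using that at_v[OF that] card_base base k by (auto simp: role_def H_def)
    have "?end c = v" if "c \<in> agents - {s} - H" for c
      using rest[of c] role_c at_v that only_v by auto
    then have "agents - {s} - H \<subseteq> {b \<in> agents. ?end b = v}" by auto
    then have "card (agents - {s} - H) \<le> card {b \<in> agents. ?end b = v}"
      by (rule card_mono[OF fin])
    moreover have "card (agents - {s} - H) = k - 1 - g"
      using card_H card_base base H_agents finite_agents
      by (metis card_Diff_subset finite_Diff finite_subset)
    ultimately have stay: "g \<le> card {b \<in> agents. ?end b = v}" using k by simp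
    obtain h where h: "h \<in> H" using card_H g by fastforce
    then have h': "h \<in> agents" "h \<noteq> s" using H_agents by auto
    have "?end c = ?end h" if "c \<in> H" for c
    proof -
      have c: "c \<in> agents" "c \<noteq> s" using that H_agents by auto
      then have "path ?L c (2 * n) = path ?L h (2 * n)"
        using path_determined[of c h ?L "2 * n"] role_c at_v that h h' by simp
      then show ?thesis by (simp only: path_end)
    qed
    then have "H \<subseteq> {b \<in> agents. ?end b = ?end h}" using H_agents by auto
    then have march: "g \<le> card {b \<in> agents. ?end b = ?end h}"
      using card_mono[OF fin] card_H by metis
    \<comment> \<open>The marchers start at \<open>v\<close>, so they catch a seeker that avoids
      \<open>v\<close>. They may themselves end at \<open>v\<close>, which does no harm.\<close>
    have "?end s = v \<or> ?end s = ?end h"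
    proof (rule ccontr)
      assume contr: "\<not> ?thesis"
      let ?m = "\<lambda>r. missing (census n ?L + 1 + r)"
      have avoid: "path ?L s r \<noteq> v" if "r \<le> 2 * n" for r
        using seeker_avoids[OF s_agent, of ?L r] role_s contr only_v that by simp
      have "\<forall>r<2 * n. path ?L h (Suc r) = travel n (?m r) (path ?L h r) Forward"
        using path_Suc[OF h'(1), of ?L] role_c h h' by (simp del: travel_simps)
      moreover have "\<forall>r<2 * n. path ?L s (Suc r) = travel n (?m r) (path ?L s r) Forward"
        using path_Suc[OF s_agent, of ?L] role_s avoid only_v by (simp del: travel_simps)
      moreover have "path ?L h 0 = v" using path_0 at_v h' by simp
      ultimately have "path ?L h (2 * n) = path ?L s (2 * n)"
        using forward_chaser_catches[of "2 * n" "path ?L h" n ?m "path ?L s"]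
          path_less[OF s_agent, of ?L 0] v avoid by simp
      then show False using contr path_end by simp
    qed
    moreover have "?end a = v \<or> ?end a = ?end h" if "a \<noteq> s"
      using that a \<open>\<And>c. c \<in> H \<Longrightarrow> ?end c = ?end h\<close>
        \<open>\<And>c. c \<in> agents - {s} - H \<Longrightarrow> ?end c = v\<close> by blast
    ultimately show ?thesis using stay march by metis
  qed
qed

end

section \<open>Encoding as a protocol of finite automata\<close>

definition finish :: "nat \<Rightarrow> nat \<Rightarrow> nat" where
  "finish n g = census n (Suc (levels g))"

definition encode_state :: "nat \<Rightarrow> nat \<Rightarrow> nat \<Rightarrow> nat" where
  "encode_state t m e = prod_encode (t, prod_encode (m, e))"

definition clock :: "nat \<Rightarrow> nat" where
  "clock s = fst (prod_decode s)"

definition memory :: "nat \<Rightarrow> nat" where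
  "memory s = fst (prod_decode (snd (prod_decode s)))"

definition search_mode :: "nat \<Rightarrow> nat" where
  "search_mode s = snd (prod_decode (snd (prod_decode s)))"

lemma decode_state [simp]:
  "clock (encode_state t m e) = t"
  "memory (encode_state t m e) = m"
  "search_mode (encode_state t m e) = e"
  by (simp_all add: encode_state_def clock_def memory_def search_mode_def)

text \<open>The binary digits of a whiteboard mark a finite set of encoded pairs of round and
  ID.\<close>

definition records :: "nat \<Rightarrow> (nat \<times> nat) set" where
  "records w = prod_decode ` set_decode w"

definition add_record :: "nat \<times> nat \<Rightarrow> nat \<Rightarrow> nat" where
  "add_record x w = set_encode (insert (prod_encode x) (set_decode w))"

lemma records_0 [simp]: "records 0 = {}"
  by (simp add: records_def)

lemma records_add [simp]: "records (add_record x w) = insert x (records w)"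
  by (simp add: records_def add_record_def)

lemma finite_records [simp]: "finite (records w)"
  by (simp add: records_def)

definition recorded_before :: "nat \<Rightarrow> nat \<Rightarrow> (nat \<times> nat) set" where
  "recorded_before t w = {x \<in> records w. fst x < t}"

text \<open>The record \<open>(finish n g, 0)\<close> on home nodes only distinguishes the two initial whiteboards:
  agents never look at records of time \<open>finish n g\<close>. They also ignore the records of the current
  round, which makes the order of actions within a round irrelevant.\<close>

definition gathering_protocol :: "nat \<Rightarrow> nat \<Rightarrow> nat \<Rightarrow> protocol" where
  "gathering_protocol n k g =
     \<lparr> init_state = (\<lambda>a. encode_state 0 a 1),
       final_states = {s. finish n g \<le> clock s},
       board_empty = set_encode {},
       board_home = add_record (finish n g, 0) (set_encode {}),
       delta = (\<lambda>a s w.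
         let t = clock s; V = recorded_before t w;
             m = Min (insert (memory s) (snd ` V));
             e = next_mode n k g t a (search_mode s) V
         in if finish n g \<le> t then (s, w, Stay)
            else (encode_state (Suc t) m e, add_record (t, a) w, heading n g t m e V)) \<rparr>"

text \<open>Earlier agents of the round only add records of time \<open>t\<close>, which
  \<open>recorded_before t\<close> hides. So each agent acts as if it were first, and the sequential
  round equals a simultaneous step.\<close>

lemma fold_act_gathering_protocol:
  fixes c :: config and n k g t :: nat and xs :: "nat list" and m :: "nat option"
  assumes "t < finish n g" "distinct xs" "\<forall>a\<in>set xs. clock (state c a) = t"
  defines "V \<equiv> \<lambda>a. recorded_before t (board c (loc c a))"
  defines "M \<equiv> \<lambda>a. Min (insert (memory (state c a)) (snd ` V a))"
    and "D \<equiv> \<lambda>a. next_mode n k g t a (search_mode (state c a)) (V a)"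
    and "c' \<equiv> fold (act (gathering_protocol n k g) n m) xs c"
  shows "loc c' = (\<lambda>a. if a \<in> set xs then travel n m (loc c a) (heading n g t (M a) (D a) (V a))
      else loc c a)
    \<and> state c' = (\<lambda>a. if a \<in> set xs then encode_state (Suc t) (M a) (D a) else state c a)
    \<and> (\<forall>v. records (board c' v) = records (board c v) \<union> {(t, a) | a. a \<in> set xs \<and> loc c a = v})
    \<and> moves c' \<le> moves c + length xs"
  using assms(2,3) unfolding c'_def
proof (induction xs rule: rev_induct)
  case (snoc x xs)
  define d where "d = fold (act (gathering_protocol n k g) n m) xs c"
  have x: "x \<notin> set xs" "clock (state c x) = t" using snoc.prems by auto
  have d: "loc d = (\<lambda>a. if a \<in> set xs then travel n m (loc c a) (heading n g t (M a) (D a) (V a))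
      else loc c a)"
    "state d = (\<lambda>a. if a \<in> set xs then encode_state (Suc t) (M a) (D a) else state c a)"
    "\<And>v. records (board d v) = records (board c v) \<union> {(t, a) | a. a \<in> set xs \<and> loc c a = v}"
    "moves d \<le> moves c + length xs"
    using snoc unfolding d_def by auto
  have same: "loc d x = loc c x" "state d x = state c x" using d(1,2) x by auto
  have view: "recorded_before t (board d (loc c x)) = V x"
    unfolding recorded_before_def V_def d(3) by auto
  have act: "act (gathering_protocol n k g) n m x d =
      \<lparr> loc = (loc d)(x := travel n m (loc c x) (heading n g t (M x) (D x) (V x))),
        state = (state d)(x := encode_state (Suc t) (M x) (D x)),
        board = (board d)(loc c x := add_record (t, x) (board d (loc c x))),
        moves = (if traverses n m (loc c x) (heading n g t (M x) (D x) (V x))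
                 then Suc (moves d) else moves d) \<rparr>"
    using assms(1) x same view
    by (auto simp: act_def gathering_protocol_def Let_def M_def D_def travel_def fun_upd_idem)
  show ?case
    unfolding fold_append comp_apply d_def[symmetric] fold.simps id_apply act
    using d x by (auto simp: fun_eq_iff)
qed simp

text \<open>The cutoff \<open>finish n g\<close> hides only the marker on home nodes, so what
  remains is the history of positions.\<close>

lemma run_gathering_protocol:
  fixes n k g E
  defines "P \<equiv> gathering_protocol n k g"
  assumes E: "valid_scenario n k E" and t: "t \<le> finish n g"
  shows "(\<forall>a\<in>ids E. clock (state (run P n E t) a) = t)
    \<and> (\<forall>v. recorded_before (finish n g) (board (run P n E t) v)
         = {(s, b). s < t \<and> b \<in> ids E \<and> loc (run P n E s) b = v})
    \<and> moves (run P n E t) \<le> k * t"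
  using t
proof (induction t)
  case 0
  then show ?case
    by (auto simp: P_def gathering_protocol_def init_config_def recorded_before_def)
next
  case (Suc t)
  have sched: "distinct (schedule E t)" "set (schedule E t) = ids E" "card (ids E) = k"
    using E by (auto simp: valid_scenario_def)
  then have len: "length (schedule E t) = k" using distinct_card[OF sched(1)] by simp
  have "\<forall>a\<in>set (schedule E t). clock (state (run P n E t) a) = t" "t < finish n g"
    using Suc sched by auto
  note fold = fold_act_gathering_protocol[OF this(2) sched(1) this(1), of k "missing E t", folded P_def]
  have "recorded_before (finish n g) (board (run P n E (Suc t)) v)
      = {(s, b). s < Suc t \<and> b \<in> ids E \<and> loc (run P n E s) b = v}" for v
  proof -
    have "recorded_before (finish n g) (board (run P n E (Suc t)) v)
      = recorded_before (finish n g) (board (run P n E t) v)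
        \<union> {(t, a) | a. a \<in> ids E \<and> loc (run P n E t) a = v}"
      using fold sched Suc.prems by (auto simp: recorded_before_def)
    also have "recorded_before (finish n g) (board (run P n E t) v)
      = {(s, b). s < t \<and> b \<in> ids E \<and> loc (run P n E s) b = v}" using Suc by simp
    finally show ?thesis by (auto simp: less_Suc_eq)
  qed
  moreover have "moves (run P n E (Suc t)) \<le> k * Suc t"
    using fold len Suc by auto
  moreover have "\<forall>a\<in>ids E. clock (state (run P n E (Suc t)) a) = Suc t"
    using fold sched by auto
  ultimately show ?case by blast
qed

lemma gathering_run_protocol:
  fixes n k g E
  defines "P \<equiv> gathering_protocol n k g"
  assumes E: "valid_scenario n k E" and "3 \<le> g" "2 * g + 1 \<le> k" "k \<le> n"
  shows "gathering_run n k g (ids E) (missing E) (\<lambda>t. loc (run P n E t))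
    (\<lambda>t a. memory (state (run P n E t) a)) (\<lambda>t a. search_mode (state (run P n E t) a))
    (\<lambda>t v. {(s, b). s < t \<and> b \<in> ids E \<and> loc (run P n E s) b = v})"
proof -
  have step: "loc (run P n E (Suc t)) a = travel n (missing E t) (loc (run P n E t) a)
        (heading n g t (memory (state (run P n E (Suc t)) a)) (search_mode (state (run P n E (Suc t)) a)) V)
      \<and> memory (state (run P n E (Suc t)) a) = Min (insert (memory (state (run P n E t) a)) (snd ` V))
      \<and> search_mode (state (run P n E (Suc t)) a)
        = next_mode n k g t a (search_mode (state (run P n E t) a)) V"
    if a: "a \<in> ids E" and t: "t < finish n g"
      and V: "V = {(s, b). s < t \<and> b \<in> ids E \<and> loc (run P n E s) b = loc (run P n E t) a}"
    for a t V
  proof -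
    have sched: "distinct (schedule E t)" "set (schedule E t) = ids E"
      using E by (auto simp: valid_scenario_def)
    note inv = run_gathering_protocol[OF E less_imp_le[OF t], folded P_def]
    have "recorded_before t (board (run P n E t) (loc (run P n E t) a))
        = {x \<in> recorded_before (finish n g) (board (run P n E t) (loc (run P n E t) a)). fst x < t}"
      using t by (auto simp: recorded_before_def)
    also have "\<dots> = V" using inv V by auto
    finally have view: "recorded_before t (board (run P n E t) (loc (run P n E t) a)) = V" .
    have "\<forall>a\<in>set (schedule E t). clock (state (run P n E t) a) = t" using inv sched by blast
    note fold = fold_act_gathering_protocol[OF t sched(1) this, of k "missing E t",
        folded P_def]
    show ?thesis using fold sched(2) a view by (simp del: travel_simps)
  qed
  have "state (run P n E 0) a = encode_state 0 a 1" "loc (run P n E 0) = home E" for a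
    by (simp_all add: P_def gathering_protocol_def init_config_def)
  then show ?thesis
    using E assms(3-) step[OF _ _ refl, folded finish_def]
    by unfold_locales (auto simp: valid_scenario_def finish_def simp del: run.simps travel_simps)
qed

lemma next_mode_le: "e \<le> 2 \<Longrightarrow> next_mode n k g t a e V \<le> 2"
  by (auto simp: next_mode_def Let_def)

text \<open>The clock stops at \<open>finish n g\<close>, and taking minima never lifts the memory
  above the bound on IDs.\<close>

lemma finite_automata_gathering_protocol: "finite_automata (gathering_protocol n k g)"
  unfolding finite_automata_def
proof (intro conjI allI)
  let ?P = "gathering_protocol n k g"
  have "records (board_empty ?P) \<noteq> records (board_home ?P)"
    by (simp add: gathering_protocol_def)
  then show "board_empty ?P \<noteq> board_home ?P" by metis
  fix N
  define S where "S = (\<lambda>(t, m, e). encode_state t m e) ` ({..finish n g} \<times> {..N} \<times> {..2})"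
  \<comment> \<open>The inclusive bounds keep the marker \<open>(finish n g, 0)\<close> in
    \<open>R\<close> even for \<open>N = 0\<close>.\<close>
  define R where "R = {..finish n g} \<times> {..N}"
  define W where "W = {w. records w \<subseteq> R}"
  have "W \<subseteq> set_encode ` Pow (prod_encode ` R)"
  proof
    fix w assume "w \<in> W"
    then have "set_decode w \<subseteq> prod_encode ` R"
      by (auto simp: W_def records_def intro!: rev_image_eqI[where x = "prod_decode _"])
    then show "w \<in> set_encode ` Pow (prod_encode ` R)"
      by (intro image_eqI[where x = "set_decode w"]) auto
  qed
  then have "finite W" by (rule finite_subset) (simp add: R_def)
  moreover have "finite S" by (simp add: S_def)
  moreover have "board_empty ?P \<in> W" "board_home ?P \<in> W"
    by (auto simp: W_def R_def gathering_protocol_def)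
  moreover have "init_state ?P a \<in> S" if "a < N" for a
    using that by (auto simp: S_def gathering_protocol_def intro!: image_eqI[where x = "(0, a, 1)"])
  moreover have "delta ?P a s w \<in> S \<times> W \<times> UNIV" if "a < N" "s \<in> S" "w \<in> W" for a s w
  proof -
    obtain t m e where s: "s = encode_state t m e" "t \<le> finish n g" "m \<le> N" "e \<le> 2"
      using \<open>s \<in> S\<close> by (auto simp: S_def)
    let ?V = "recorded_before t w"
    have "finite ?V" by (simp add: recorded_before_def)
    then have "Min (insert m (snd ` ?V)) \<le> m" by (intro Min_le) auto
    then have "Min (insert m (snd ` ?V)) \<le> N" using s(3) by simp
    then have "encode_state (Suc t) (Min (insert m (snd ` ?V))) (next_mode n k g t a e ?V) \<in> S"
      if "t < finish n g"
      using that s(4) next_mode_le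
      by (auto simp: S_def intro!: image_eqI[where x = "(Suc t, Min (insert m (snd ` ?V)), next_mode n k g t a e ?V)"])
    moreover have "add_record (t, a) w \<in> W"
      using \<open>w \<in> W\<close> s(2) \<open>a < N\<close> by (auto simp: W_def R_def)
    ultimately show ?thesis using that s by (auto simp: gathering_protocol_def Let_def)
  qed
  ultimately show "\<exists>S W. finite S \<and> finite W \<and> board_empty ?P \<in> W \<and> board_home ?P \<in> W \<and>
      (\<forall>a<N. init_state ?P a \<in> S) \<and>
      (\<forall>a<N. \<forall>s\<in>S. \<forall>w\<in>W. delta ?P a s w \<in> S \<times> W \<times> UNIV)"
    by (intro exI[of _ S] exI[of _ W] conjI allI impI ballI)
qed

section \<open>Complexity bounds and the main result\<close>

text \<open>All clocks show the round number, so all agents become final together;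
  \<open>0 < k\<close> supplies one that is not final earlier.\<close>

lemma rounds_gathering_protocol:
  fixes n k g E
  defines "P \<equiv> gathering_protocol n k g"
  assumes E: "valid_scenario n k E" and "0 < k"
  shows "all_terminated P E (run P n E (finish n g))" "rounds P n E = finish n g"
proof -
  have clock: "clock (state (run P n E t) a) = t" if "t \<le> finish n g" "a \<in> ids E" for t a
    using run_gathering_protocol[OF E that(1)] that(2) by (simp add: P_def)
  have final: "final_states P = {s. finish n g \<le> clock s}"
    by (simp add: P_def gathering_protocol_def)
  show T: "all_terminated P E (run P n E (finish n g))"
    using clock by (simp add: all_terminated_def final)
  obtain a where "a \<in> ids E" using E \<open>0 < k\<close> by (fastforce simp: valid_scenario_def)
  then have "finish n g \<le> t" if "all_terminated P E (run P n E t)" for t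
    using that clock[of t a] by (cases "t \<le> finish n g") (auto simp: all_terminated_def final)
  then show "rounds P n E = finish n g"
    unfolding rounds_def using T by (intro Least_equality)
qed

lemma finish_bound:
  assumes "3 \<le> g" "0 < n"
  shows "real (finish n g) \<le> 20 * (real n * ln (real g))"
proof -
  \<comment> \<open>The change to natural logarithms rests on \<open>ln g \<ge> 1\<close>, from
    \<open>e \<le> 3\<close>, and \<open>ln 2 \<ge> 1 / 2\<close>, from
    \<open>e \<le> 4\<close>.\<close>
  have "exp 1 \<le> real g" using exp_le assms by linarith
  then have ln_g: "1 \<le> ln (real g)" using assms by (simp add: ln_ge_iff)
  have "exp 1 \<le> (4::real)" using exp_le by linarith
  then have "1 \<le> ln (2 * 2 :: real)" by (simp add: ln_ge_iff)
  then have "1 / 2 \<le> ln (2::real)" by (subst (asm) ln_mult) auto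
  then have "log 2 (real g) \<le> 2 * ln (real g)"
    using ln_g by (simp add: log_def field_simps)
  moreover have "real (levels g) \<le> log 2 (real g) + 1"
    using assms unfolding levels_def by (simp add: of_nat_ceiling)
  ultimately have L: "real (levels g) \<le> 3 * ln (real g)" using ln_g by linarith
  have "finish n g \<le> n * (9 + 3 * levels g)"
    using assms by (cases n) (auto simp: finish_def census_def algebra_simps)
  then have "real (finish n g) \<le> real n * (9 + 3 * real (levels g))"
    by (metis (mono_tags) of_nat_le_iff of_nat_mult of_nat_add of_nat_numeral)
  \<comment> \<open>\<open>9 + 3 * levels g\<close> is at most \<open>9 + 9 * ln g\<close>, hence at
    most \<open>18 * ln g\<close>.\<close>
  also have "\<dots> \<le> real n * (20 * ln (real g))"
    using L ln_g by (intro mult_left_mono) auto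
  finally show ?thesis by (simp add: algebra_simps)
qed

theorem theorem4:
  "\<exists>(A :: nat \<Rightarrow> nat \<Rightarrow> nat \<Rightarrow> protocol) (C :: real). C > 0 \<and>
     (\<forall>n k g :: nat. 2 * g + 1 \<le> k \<and> k \<le> 3 * g - 2 \<and> k \<le> n \<longrightarrow>
        finite_automata (A n k g) \<and>
        solves_partial_gathering (A n k g) n k g \<and>
        (\<forall>E. valid_scenario n k E \<longrightarrow>
           real (rounds (A n k g) n E) \<le> C * (real n * ln (real g)) \<and>
           real (total_moves (A n k g) n E) \<le> C * (real g * real n * ln (real g))))"
\<comment> \<open>60 is \<open>3 * 20\<close>: at most \<open>k \<le> 3 * g\<close> moves in each of
  at most \<open>20 * n * ln g\<close> rounds.\<close>
proof (intro exI[of _ gathering_protocol] exI[of _ 60] conjI allI impI)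
  fix n k g :: nat
  let ?P = "gathering_protocol n k g"
  assume "2 * g + 1 \<le> k \<and> k \<le> 3 * g - 2 \<and> k \<le> n"
  then have k: "3 \<le> g" "2 * g + 1 \<le> k" "k \<le> n" "k \<le> 3 * g" "0 < k" "0 < n" by auto
  show "finite_automata ?P" by (rule finite_automata_gathering_protocol)
  show "solves_partial_gathering ?P n k g"
    unfolding solves_partial_gathering_def
  proof (intro allI impI conjI)
    fix E assume E: "valid_scenario n k E"
    show "halts ?P n E"
      using rounds_gathering_protocol(1)[OF E k(5)] unfolding halts_def by blast
    show "partially_gathered g E (final_config ?P n E)"
      using gathering_run.gathered[OF gathering_run_protocol[OF E k(1-3)]]
      unfolding partially_gathered_def final_config_def rounds_gathering_protocol(2)[OF E k(5)]
        finish_def by blast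
  qed
  fix E assume E: "valid_scenario n k E"
  note bound = finish_bound[OF k(1,6)]
  have "0 \<le> real n * ln (real g)" using k by simp
  then show "real (rounds ?P n E) \<le> 60 * (real n * ln (real g))"
    unfolding rounds_gathering_protocol(2)[OF E k(5)] using bound by linarith
  have "total_moves ?P n E \<le> k * finish n g"
    unfolding total_moves_def final_config_def rounds_gathering_protocol(2)[OF E k(5)]
    using run_gathering_protocol[OF E order_refl] by simp
  then have "real (total_moves ?P n E) \<le> real k * real (finish n g)"
    by (metis of_nat_le_iff of_nat_mult)
  also have "\<dots> \<le> (3 * real g) * (20 * (real n * ln (real g)))"
    using bound k by (intro mult_mono) auto
  finally show "real (total_moves ?P n E) \<le> 60 * (real g * real n * ln (real g))"
    by (simp add: algebra_simps)
qed simp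

end
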